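(* Let $\mathsf{C}$ be a category and $(T,\mu,\eta)$ a monad on $\mathsf{C}$. Let $S:\mathsf{C}\to\mathsf{C}$ be a functor that lifts to a functor $\overline{S}:\mathcal{K}l(T)\to\mathcal{K}l(T)$, and let $(\overline{S},m,e)$ be a monad on $\mathcal{K}l(T)$. Assume that $\mathcal{K}l(T)$ is $\mathbf{Cppo}$-enriched and that $\overline{S}$ is locally continuous. Then the Kleisli category $\mathcal{K}l(TS)=\mathcal{K}l(\overline{S})$ is $\mathbf{Cppo}$-enriched, where the hom-set from $X$ to $Y$ in $\mathcal{K}l(\overline{S})$ is $Hom_{\mathcal{K}l(T)}(X,\overline{S}Y)$ carrying the order of $\mathcal{K}l(T)$.
   Context: The Kleisli category $\mathcal{K}l(T)$ has the objects of $\mathsf{C}$; a morphism $X\multimap Y$ is a $\mathsf{C}$-morphism $X\to TY$; composition is $g\cdot f=\mu_Z\circ Tg\circ f$ and identities are $\eta_X$. For $f:X\to Y$ in $\mathsf{C}$ put $f^\sharp=\eta_Y\circ f:X\multimap Y$. A functor $S$ on $\mathsf{C}$ lifts to $\overline{S}$ on $\mathcal{K}l(T)$ if $\overline{S}X=SX$ for all objects and $\overline{S}(f^\sharp)=(Sf)^\sharp$ for all $f$ in $\mathsf{C}$. For a monad $(\overline{S},m,e)$ on $\mathcal{K}l(T)$, the Kleisli category $\mathcal{K}l(\overline{S})$ has morphisms $X\multimap \overline{S}Y$ in $\mathcal{K}l(T)$ with composition $g\ast f=m_Z\cdot\overline{S}g\cdot f$ and identities $e_X$; the composite adjunction $\mathsf{C}\rightleftarrows\mathcal{K}l(T)\rightleftarrows\mathcal{K}l(\overline{S})$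 makes $TS$ a monad on $\mathsf{C}$ with $\mathcal{K}l(TS)=\mathcal{K}l(\overline{S})$. A category is $\mathbf{Cppo}$-enriched if every hom-set is a poset with a least element, every ascending $\omega$-chain in a hom-set has a supremum, and composition on either side preserves suprema of ascending $\omega$-chains (it is not required that the least element be absorbing). A functor between $\mathbf{Cppo}$-enriched categories is locally continuous if it preserves suprema of ascending $\omega$-chains on hom-sets. *)

theory Defs
  imports Main
begin

text \<open>
  Hom-sets are indexed by pairs of objects and need not be pairwise disjoint: one base morphism
  into \<open>T Y = T Y'\<close> belongs to two hom-sets of the Kleisli category. Composition and the action
  of a functor on morphisms therefore take the objects involved as arguments:
  \<open>Cmp C X Y Z g f\<close> is the composite of \<open>f : X \<rightarrow> Y\<close> and \<open>g : Y \<rightarrow> Z\<close>, and \<open>amap F X Y f\<close> is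
  \<open>F f\<close> for \<open>f : X \<rightarrow> Y\<close>. Values outside the objects and hom-sets carry no meaning.
\<close>

record ('o, 'm) cat =
  Ob :: "'o set"
  Hom :: "'o \<Rightarrow> 'o \<Rightarrow> 'm set"
  Cmp :: "'o \<Rightarrow> 'o \<Rightarrow> 'o \<Rightarrow> 'm \<Rightarrow> 'm \<Rightarrow> 'm"
  Idt :: "'o \<Rightarrow> 'm"

locale category =
  fixes C :: "('o, 'm) cat"
  assumes Idt_in_Hom: "X \<in> Ob C \<Longrightarrow> Idt C X \<in> Hom C X X"
    and Cmp_in_Hom: "\<lbrakk>X \<in> Ob C; Y \<in> Ob C; Z \<in> Ob C; f \<in> Hom C X Y; g \<in> Hom C Y Z\<rbrakk>
      \<Longrightarrow> Cmp C X Y Z g f \<in> Hom C X Z"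
    and Cmp_Idt_left: "\<lbrakk>X \<in> Ob C; Y \<in> Ob C; f \<in> Hom C X Y\<rbrakk>
      \<Longrightarrow> Cmp C X Y Y (Idt C Y) f = f"
    and Cmp_Idt_right: "\<lbrakk>X \<in> Ob C; Y \<in> Ob C; f \<in> Hom C X Y\<rbrakk>
      \<Longrightarrow> Cmp C X X Y f (Idt C X) = f"
    and Cmp_assoc: "\<lbrakk>W \<in> Ob C; X \<in> Ob C; Y \<in> Ob C; Z \<in> Ob C;
        f \<in> Hom C W X; g \<in> Hom C X Y; h \<in> Hom C Y Z\<rbrakk>
      \<Longrightarrow> Cmp C W Y Z h (Cmp C W X Y g f) = Cmp C W X Z (Cmp C X Y Z h g) f"

definition same_category :: "('o, 'm) cat \<Rightarrow> ('o, 'm) cat \<Rightarrow> bool" where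
  "same_category C D \<longleftrightarrow>
     Ob C = Ob D \<and>
     (\<forall>X\<in>Ob C. \<forall>Y\<in>Ob C. Hom C X Y = Hom D X Y) \<and>
     (\<forall>X\<in>Ob C. Idt C X = Idt D X) \<and>
     (\<forall>X\<in>Ob C. \<forall>Y\<in>Ob C. \<forall>Z\<in>Ob C. \<forall>f\<in>Hom C X Y. \<forall>g\<in>Hom C Y Z.
        Cmp C X Y Z g f = Cmp D X Y Z g f)"

record ('o, 'm, 'p, 'n) fctr =
  omap :: "'o \<Rightarrow> 'p"
  amap :: "'o \<Rightarrow> 'o \<Rightarrow> 'm \<Rightarrow> 'n"

locale cat_functor = source: category C + target: category D
  for C :: "('o, 'm) cat" and D :: "('p, 'n) cat" +
  fixes F :: "('o, 'm, 'p, 'n) fctr"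
  assumes omap_in_Ob: "X \<in> Ob C \<Longrightarrow> omap F X \<in> Ob D"
    and amap_in_Hom: "\<lbrakk>X \<in> Ob C; Y \<in> Ob C; f \<in> Hom C X Y\<rbrakk>
      \<Longrightarrow> amap F X Y f \<in> Hom D (omap F X) (omap F Y)"
    and amap_Idt: "X \<in> Ob C \<Longrightarrow> amap F X X (Idt C X) = Idt D (omap F X)"
    and amap_Cmp: "\<lbrakk>X \<in> Ob C; Y \<in> Ob C; Z \<in> Ob C; f \<in> Hom C X Y; g \<in> Hom C Y Z\<rbrakk>
      \<Longrightarrow> amap F X Z (Cmp C X Y Z g f)
        = Cmp D (omap F X) (omap F Y) (omap F Z) (amap F Y Z g) (amap F X Y f)"

definition same_functor ::
    "('o, 'm) cat \<Rightarrow> ('o, 'm, 'p, 'n) fctr \<Rightarrow> ('o, 'm, 'p, 'n) fctr \<Rightarrow> bool" where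
  "same_functor C F G \<longleftrightarrow>
     (\<forall>X\<in>Ob C. omap F X = omap G X) \<and>
     (\<forall>X\<in>Ob C. \<forall>Y\<in>Ob C. \<forall>f\<in>Hom C X Y. amap F X Y f = amap G X Y f)"

definition functor_comp ::
    "('p, 'n, 'q, 'l) fctr \<Rightarrow> ('o, 'm, 'p, 'n) fctr \<Rightarrow> ('o, 'm, 'q, 'l) fctr" where
  "functor_comp G F = \<lparr> omap = (\<lambda>X. omap G (omap F X)),
     amap = (\<lambda>X Y f. amap G (omap F X) (omap F Y) (amap F X Y f)) \<rparr>"

locale cat_monad = cat_functor C C T
  for C :: "('o, 'm) cat" and T :: "('o, 'm, 'o, 'm) fctr" +
  fixes \<mu> :: "'o \<Rightarrow> 'm" and \<eta> :: "'o \<Rightarrow> 'm"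
  assumes unit_in_Hom: "X \<in> Ob C \<Longrightarrow> \<eta> X \<in> Hom C X (omap T X)"
    and mult_in_Hom: "X \<in> Ob C \<Longrightarrow> \<mu> X \<in> Hom C (omap T (omap T X)) (omap T X)"
    and unit_natural: "\<lbrakk>X \<in> Ob C; Y \<in> Ob C; f \<in> Hom C X Y\<rbrakk>
      \<Longrightarrow> Cmp C X (omap T X) (omap T Y) (amap T X Y f) (\<eta> X)
        = Cmp C X Y (omap T Y) (\<eta> Y) f"
    and mult_natural: "\<lbrakk>X \<in> Ob C; Y \<in> Ob C; f \<in> Hom C X Y\<rbrakk>
      \<Longrightarrow> Cmp C (omap T (omap T X)) (omap T X) (omap T Y) (amap T X Y f) (\<mu> X)
        = Cmp C (omap T (omap T X)) (omap T (omap T Y)) (omap T Y) (\<mu> Y)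
            (amap T (omap T X) (omap T Y) (amap T X Y f))"
    and mult_unit: "X \<in> Ob C
      \<Longrightarrow> Cmp C (omap T X) (omap T (omap T X)) (omap T X) (\<mu> X) (\<eta> (omap T X))
        = Idt C (omap T X)"
    and mult_amap_unit: "X \<in> Ob C
      \<Longrightarrow> Cmp C (omap T X) (omap T (omap T X)) (omap T X) (\<mu> X) (amap T X (omap T X) (\<eta> X))
        = Idt C (omap T X)"
    and mult_assoc: "X \<in> Ob C
      \<Longrightarrow> Cmp C (omap T (omap T (omap T X))) (omap T (omap T X)) (omap T X)
            (\<mu> X) (\<mu> (omap T X))
        = Cmp C (omap T (omap T (omap T X))) (omap T (omap T X)) (omap T X)
            (\<mu> X) (amap T (omap T (omap T X)) (omap T X) (\<mu> X))"

definition kleisli ::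
    "('o, 'm) cat \<Rightarrow> ('o, 'm, 'o, 'm) fctr \<Rightarrow> ('o \<Rightarrow> 'm) \<Rightarrow> ('o \<Rightarrow> 'm) \<Rightarrow> ('o, 'm) cat" where
  "kleisli C T \<mu> \<eta> = \<lparr>
     Ob = Ob C,
     Hom = (\<lambda>X Y. Hom C X (omap T Y)),
     Cmp = (\<lambda>X Y Z g f. Cmp C X (omap T (omap T Z)) (omap T Z) (\<mu> Z)
       (Cmp C X (omap T Y) (omap T (omap T Z)) (amap T Y (omap T Z) g) f)),
     Idt = \<eta> \<rparr>"

definition sharp ::
    "('o, 'm) cat \<Rightarrow> ('o, 'm, 'o, 'm) fctr \<Rightarrow> ('o \<Rightarrow> 'm) \<Rightarrow> 'o \<Rightarrow> 'o \<Rightarrow> 'm \<Rightarrow> 'm" where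
  "sharp C T \<eta> X Y f = Cmp C X Y (omap T Y) (\<eta> Y) f"

definition lifts_to ::
    "('o, 'm) cat \<Rightarrow> ('o, 'm, 'o, 'm) fctr \<Rightarrow> ('o \<Rightarrow> 'm) \<Rightarrow> ('o \<Rightarrow> 'm)
      \<Rightarrow> ('o, 'm, 'o, 'm) fctr \<Rightarrow> ('o, 'm, 'o, 'm) fctr \<Rightarrow> bool" where
  "lifts_to C T \<mu> \<eta> S S' \<longleftrightarrow>
     cat_functor C C S \<and>
     cat_functor (kleisli C T \<mu> \<eta>) (kleisli C T \<mu> \<eta>) S' \<and>
     (\<forall>X\<in>Ob C. omap S' X = omap S X) \<and>
     (\<forall>X\<in>Ob C. \<forall>Y\<in>Ob C. \<forall>f\<in>Hom C X Y.
        amap S' X Y (sharp C T \<eta> X Y f)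
          = sharp C T \<eta> (omap S X) (omap S Y) (amap S X Y f))"

record ('o, 'm, 'p, 'n) adjunction =
  left :: "('o, 'm, 'p, 'n) fctr"
  right :: "('p, 'n, 'o, 'm) fctr"
  unit :: "'o \<Rightarrow> 'm"
  counit :: "'p \<Rightarrow> 'n"

text \<open>
  The counit of the Kleisli adjunction at \<open>X\<close> is the Kleisli morphism from \<open>T X\<close> to \<open>X\<close> given by
  the identity of \<open>T X\<close> in the base category.
\<close>

definition kleisli_adjunction ::
    "('o, 'm) cat \<Rightarrow> ('o, 'm, 'o, 'm) fctr \<Rightarrow> ('o \<Rightarrow> 'm) \<Rightarrow> ('o \<Rightarrow> 'm)
      \<Rightarrow> ('o, 'm, 'o, 'm) adjunction" where
  "kleisli_adjunction C T \<mu> \<eta> = \<lparr>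
     left = \<lparr> omap = (\<lambda>X. X), amap = sharp C T \<eta> \<rparr>,
     right = \<lparr> omap = omap T,
       amap = (\<lambda>X Y g. Cmp C (omap T X) (omap T (omap T Y)) (omap T Y) (\<mu> Y)
         (amap T X (omap T Y) g)) \<rparr>,
     unit = \<eta>,
     counit = (\<lambda>X. Idt C (omap T X)) \<rparr>"

text \<open>Composite of an adjunction \<open>A\<close> from \<open>C\<close> to \<open>D\<close> with an adjunction \<open>B\<close> from \<open>D\<close> to \<open>E\<close>.\<close>

definition adjunction_comp ::
    "('o, 'm) cat \<Rightarrow> ('q, 'l) cat \<Rightarrow> ('o, 'm, 'p, 'n) adjunction
      \<Rightarrow> ('p, 'n, 'q, 'l) adjunction \<Rightarrow> ('o, 'm, 'q, 'l) adjunction" where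
  "adjunction_comp C E A B = \<lparr>
     left = functor_comp (left B) (left A),
     right = functor_comp (right A) (right B),
     unit = (\<lambda>X.
       let LX = omap (left A) X; RLX = omap (right B) (omap (left B) LX)
       in Cmp C X (omap (right A) LX) (omap (right A) RLX)
            (amap (right A) LX RLX (unit B LX)) (unit A X)),
     counit = (\<lambda>Z.
       let RZ = omap (right B) Z; LRZ = omap (left A) (omap (right A) RZ)
       in Cmp E (omap (left B) LRZ) (omap (left B) RZ) Z
            (counit B Z) (amap (left B) LRZ RZ (counit A RZ))) \<rparr>"

definition adjunction_mult :: "('o, 'm, 'p, 'n) adjunction \<Rightarrow> 'o \<Rightarrow> 'm" where
  "adjunction_mult A X =
     (let LX = omap (left A) X
      in amap (right A) (omap (left A) (omap (right A) LX)) LX (counit A LX))"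

definition composite_adjunction ::
    "('o, 'm) cat \<Rightarrow> ('o, 'm, 'o, 'm) fctr \<Rightarrow> ('o \<Rightarrow> 'm) \<Rightarrow> ('o \<Rightarrow> 'm)
      \<Rightarrow> ('o, 'm, 'o, 'm) fctr \<Rightarrow> ('o \<Rightarrow> 'm) \<Rightarrow> ('o \<Rightarrow> 'm) \<Rightarrow> ('o, 'm, 'o, 'm) adjunction" where
  "composite_adjunction C T \<mu> \<eta> S' m e =
     adjunction_comp C (kleisli (kleisli C T \<mu> \<eta>) S' m e)
       (kleisli_adjunction C T \<mu> \<eta>)
       (kleisli_adjunction (kleisli C T \<mu> \<eta>) S' m e)"

definition omega_chain :: "'a set \<Rightarrow> ('a \<Rightarrow> 'a \<Rightarrow> bool) \<Rightarrow> (nat \<Rightarrow> 'a) \<Rightarrow> bool" where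
  "omega_chain A le c \<longleftrightarrow> (\<forall>n. c n \<in> A \<and> le (c n) (c (Suc n)))"

definition chain_sup :: "'a set \<Rightarrow> ('a \<Rightarrow> 'a \<Rightarrow> bool) \<Rightarrow> (nat \<Rightarrow> 'a) \<Rightarrow> 'a \<Rightarrow> bool" where
  "chain_sup A le c s \<longleftrightarrow>
     s \<in> A \<and> (\<forall>n. le (c n) s) \<and> (\<forall>u\<in>A. (\<forall>n. le (c n) u) \<longrightarrow> le s u)"

definition preserves_chain_sups ::
    "'a set \<Rightarrow> ('a \<Rightarrow> 'a \<Rightarrow> bool) \<Rightarrow> 'b set \<Rightarrow> ('b \<Rightarrow> 'b \<Rightarrow> bool) \<Rightarrow> ('a \<Rightarrow> 'b) \<Rightarrow> bool" where
  "preserves_chain_sups A le B le' h \<longleftrightarrow>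
     (\<forall>c s. omega_chain A le c \<and> chain_sup A le c s
        \<longrightarrow> chain_sup B le' (\<lambda>n. h (c n)) (h s))"

locale cppo_enriched = category C
  for C :: "('o, 'm) cat" +
  fixes le :: "'o \<Rightarrow> 'o \<Rightarrow> 'm \<Rightarrow> 'm \<Rightarrow> bool"
  assumes le_refl: "\<lbrakk>X \<in> Ob C; Y \<in> Ob C\<rbrakk> \<Longrightarrow> reflp_on (Hom C X Y) (le X Y)"
    and le_trans: "\<lbrakk>X \<in> Ob C; Y \<in> Ob C\<rbrakk> \<Longrightarrow> transp_on (Hom C X Y) (le X Y)"
    and le_antisym: "\<lbrakk>X \<in> Ob C; Y \<in> Ob C\<rbrakk> \<Longrightarrow> antisymp_on (Hom C X Y) (le X Y)"
    and least: "\<lbrakk>X \<in> Ob C; Y \<in> Ob C\<rbrakk> \<Longrightarrow> \<exists>b\<in>Hom C X Y. \<forall>f\<in>Hom C X Y. le X Y b f"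
    and chain_complete: "\<lbrakk>X \<in> Ob C; Y \<in> Ob C; omega_chain (Hom C X Y) (le X Y) c\<rbrakk>
      \<Longrightarrow> \<exists>s. chain_sup (Hom C X Y) (le X Y) c s"
    and Cmp_left_continuous: "\<lbrakk>X \<in> Ob C; Y \<in> Ob C; Z \<in> Ob C; g \<in> Hom C Y Z\<rbrakk>
      \<Longrightarrow> preserves_chain_sups (Hom C X Y) (le X Y) (Hom C X Z) (le X Z)
            (\<lambda>f. Cmp C X Y Z g f)"
    and Cmp_right_continuous: "\<lbrakk>X \<in> Ob C; Y \<in> Ob C; Z \<in> Ob C; f \<in> Hom C X Y\<rbrakk>
      \<Longrightarrow> preserves_chain_sups (Hom C Y Z) (le Y Z) (Hom C X Z) (le X Z)
            (\<lambda>g. Cmp C X Y Z g f)"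

definition locally_continuous ::
    "('o, 'm) cat \<Rightarrow> ('o \<Rightarrow> 'o \<Rightarrow> 'm \<Rightarrow> 'm \<Rightarrow> bool) \<Rightarrow> ('p, 'n) cat
      \<Rightarrow> ('p \<Rightarrow> 'p \<Rightarrow> 'n \<Rightarrow> 'n \<Rightarrow> bool) \<Rightarrow> ('o, 'm, 'p, 'n) fctr \<Rightarrow> bool" where
  "locally_continuous C le D le' F \<longleftrightarrow>
     (\<forall>X\<in>Ob C. \<forall>Y\<in>Ob C.
        preserves_chain_sups (Hom C X Y) (le X Y)
          (Hom D (omap F X) (omap F Y)) (le' (omap F X) (omap F Y)) (amap F X Y))"

end

theory Submission
  imports Defs
begin

text \<open>
  A monad on \<open>C\<close> is the same thing as a category \<open>E\<close> on the objects of \<open>C\<close> with a functor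
  \<open>R : E \<rightarrow> C\<close> such that \<open>Hom E X Y = Hom C X (R Y)\<close> and the composite of \<open>f\<close> and \<open>g\<close> in \<open>E\<close> is
  \<open>R g \<circ> f\<close>: the unit is the identity of \<open>E\<close>, the multiplication is \<open>R\<close> applied to the identity
  of \<open>R X\<close> in \<open>C\<close>, and \<open>E\<close> is the Kleisli category. Such data compose, so the Kleisli category of
  the lifted monad over that of \<open>T\<close> is a Kleisli category over \<open>C\<close>, and it only remains to
  identify its monad with \<open>TS\<close>. For the enrichment, both arguments of the composition
  \<open>m \<cdot> S' g \<cdot> f\<close> enter through composites of maps that preserve suprema of chains; such maps are
  monotone, hence closed under composition.
\<close>

section \<open>The monad carried by a Kleisli triple\<close>

locale kleisli_triple = cat_functor E C R
  for E C :: "('o, 'm) cat" and R :: "('o, 'm, 'o, 'm) fctr" +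
  assumes Ob_eq: "Ob E = Ob C"
    and Hom_eq: "\<lbrakk>X \<in> Ob C; Y \<in> Ob C\<rbrakk> \<Longrightarrow> Hom E X Y = Hom C X (omap R Y)"
    and Cmp_eq: "\<lbrakk>X \<in> Ob C; Y \<in> Ob C; Z \<in> Ob C; f \<in> Hom C X (omap R Y); g \<in> Hom C Y (omap R Z)\<rbrakk>
      \<Longrightarrow> Cmp E X Y Z g f = Cmp C X (omap R Y) (omap R Z) (amap R Y Z g) f"
begin

lemma R_Ob: "X \<in> Ob C \<Longrightarrow> omap R X \<in> Ob C"
  using omap_in_Ob Ob_eq by simp

lemma R_Hom: "\<lbrakk>X \<in> Ob C; Y \<in> Ob C; f \<in> Hom C X (omap R Y)\<rbrakk>
    \<Longrightarrow> amap R X Y f \<in> Hom C (omap R X) (omap R Y)"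
  using amap_in_Hom Ob_eq Hom_eq by simp

lemma Idt_Hom: "X \<in> Ob C \<Longrightarrow> Idt E X \<in> Hom C X (omap R X)"
  using source.Idt_in_Hom Ob_eq Hom_eq by simp

lemma R_Idt: "X \<in> Ob C \<Longrightarrow> amap R X X (Idt E X) = Idt C (omap R X)"
  using amap_Idt Ob_eq by simp

text \<open>Functoriality of \<open>R\<close>, turned so that rewriting merges two images of
  \<open>R\<close> into one.\<close>

lemma R_Cmp:
  assumes "X \<in> Ob C" "Y \<in> Ob C" "Z \<in> Ob C" "f \<in> Hom C X (omap R Y)" "g \<in> Hom C Y (omap R Z)"
  shows "Cmp C (omap R X) (omap R Y) (omap R Z) (amap R Y Z g) (amap R X Y f)
    = amap R X Z (Cmp C X (omap R Y) (omap R Z) (amap R Y Z g) f)"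
  using amap_Cmp[of X Y Z f g] assms by (simp add: Ob_eq Hom_eq Cmp_eq)

lemma R_Cmp_Idt:
  assumes "X \<in> Ob C" "Y \<in> Ob C" "f \<in> Hom C X (omap R Y)"
  shows "Cmp C X (omap R X) (omap R Y) (amap R X Y f) (Idt E X) = f"
  using source.Cmp_Idt_right[of X Y f] assms by (simp add: Ob_eq Hom_eq Cmp_eq Idt_Hom)

text \<open>The right identity law of \<open>E\<close>, precomposed with \<open>g\<close> so that it
  also fires inside right-nested composites.\<close>

lemma R_Cmp_Idt_Cmp:
  assumes "W \<in> Ob C" "X \<in> Ob C" "Y \<in> Ob C" "f \<in> Hom C X (omap R Y)" "g \<in> Hom C W X"
  shows "Cmp C W (omap R X) (omap R Y) (amap R X Y f) (Cmp C W X (omap R X) (Idt E X) g)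
    = Cmp C W X (omap R Y) f g"
  using assms by (simp add: target.Cmp_assoc R_Ob R_Hom Idt_Hom R_Cmp_Idt)

text \<open>\<open>amap_T\<close> is the left adjoint, sending \<open>f\<close> to
  \<open>Idt E Y \<circ> f\<close>, followed by \<open>R\<close>. Agreement is asked only on objects
  and hom-sets, because the lifting ties \<open>S'\<close> to \<open>S\<close> only there.\<close>

context
  fixes T :: "('o, 'm, 'o, 'm) fctr" and \<mu> \<eta> :: "'o \<Rightarrow> 'm"
  assumes omap_T: "\<And>X. X \<in> Ob C \<Longrightarrow> omap T X = omap R X"
    and amap_T: "\<And>X Y f. \<lbrakk>X \<in> Ob C; Y \<in> Ob C; f \<in> Hom C X Y\<rbrakk>
      \<Longrightarrow> amap T X Y f = amap R X Y (Cmp C X Y (omap R Y) (Idt E Y) f)"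
    and mult: "\<And>X. X \<in> Ob C \<Longrightarrow> \<mu> X = amap R (omap R X) X (Idt C (omap R X))"
    and unit: "\<And>X. X \<in> Ob C \<Longrightarrow> \<eta> X = Idt E X"
begin

lemma cat_monad: "cat_monad C T \<mu> \<eta>"
proof -
  note typing = R_Ob R_Hom Idt_Hom target.Idt_in_Hom target.Cmp_in_Hom
  note calc = typing omap_T amap_T mult unit R_Cmp R_Cmp_Idt R_Cmp_Idt_Cmp R_Idt
    target.Cmp_Idt_left target.Cmp_Idt_right
  \<comment> \<open>Both sides of functoriality of \<open>T\<close> become one \<open>R\<close> of a
    triple composite; this reassociation under \<open>R\<close> is what is left.\<close>
  have T_Cmp: "amap R X Z (Cmp C X Z (omap R Z) (Idt E Z) (Cmp C X Y Z g f)) =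
      amap R X Z (Cmp C X Y (omap R Z) (Cmp C Y Z (omap R Z) (Idt E Z) g) f)"
    if "X \<in> Ob C" "Y \<in> Ob C" "Z \<in> Ob C" "f \<in> Hom C X Y" "g \<in> Hom C Y Z" for X Y Z f g
    using that by (simp add: target.Cmp_assoc typing)
  show ?thesis
    by unfold_locales (simp_all add: calc T_Cmp)
qed

lemma same_category_kleisli: "same_category (kleisli C T \<mu> \<eta>) E"
proof -
  \<comment> \<open>Associate to \<open>(\<mu> Z \<circ> T g) \<circ> f\<close>; the first factor is
    \<open>R id \<circ> R (Idt E \<circ> g) = R (R id \<circ> Idt E \<circ> g) = R
    g\<close>.\<close>
  have "Cmp C X (omap T (omap T Z)) (omap T Z) (\<mu> Z)
      (Cmp C X (omap T Y) (omap T (omap T Z)) (amap T Y (omap T Z) g) f) = Cmp E X Y Z g f"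
    if "X \<in> Ob C" "Y \<in> Ob C" "Z \<in> Ob C" "f \<in> Hom C X (omap R Y)" "g \<in> Hom C Y (omap R Z)"
    for X Y Z f g
    using that
    by (simp add: omap_T amap_T mult target.Cmp_assoc[where h = "amap R _ _ _"] R_Ob R_Hom Idt_Hom
        target.Idt_in_Hom target.Cmp_in_Hom R_Cmp R_Cmp_Idt R_Cmp_Idt_Cmp target.Cmp_Idt_left Cmp_eq)
  then show ?thesis
    by (simp add: same_category_def kleisli_def Ob_eq Hom_eq omap_T unit)
qed

end

end

text \<open>A morphism \<open>X \<rightarrow> Y\<close> of \<open>E\<close> is one
  \<open>X \<rightarrow> P Y\<close> of \<open>D\<close>, hence
  \<open>X \<rightarrow> R (P Y)\<close> of \<open>C\<close>; composing with \<open>g\<close>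
  becomes composing with \<open>P g\<close>, then with \<open>R (P g)\<close>.\<close>

lemma kleisli_triple_comp:
  assumes "kleisli_triple E D P" and "kleisli_triple D C R"
  shows "kleisli_triple E C (functor_comp R P)"
proof -
  interpret P: kleisli_triple E D P by fact
  interpret R: kleisli_triple D C R by fact
  have amap_Cmp: "amap R (omap P X) (omap P Z) (amap P X Z (Cmp E X Y Z g f))
      = Cmp C (omap R (omap P X)) (omap R (omap P Y)) (omap R (omap P Z))
          (amap R (omap P Y) (omap P Z) (amap P Y Z g)) (amap R (omap P X) (omap P Y) (amap P X Y f))"
    if "X \<in> Ob E" "Y \<in> Ob E" "Z \<in> Ob E" "f \<in> Hom E X Y" "g \<in> Hom E Y Z" for X Y Z f g
    using that P.omap_in_Ob P.amap_in_Hom by (simp add: P.amap_Cmp R.amap_Cmp)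
  show ?thesis
    using P.R_Ob P.R_Hom
    by unfold_locales
      (simp_all add: functor_comp_def amap_Cmp,
       simp_all add: P.Ob_eq R.Ob_eq P.Hom_eq R.Hom_eq P.Cmp_eq R.Cmp_eq
        R.R_Ob R.R_Hom P.amap_Idt R.amap_Idt)
qed

section \<open>From a monad to a Kleisli triple\<close>

context cat_monad
begin

abbreviation Kl :: "('o, 'm) cat" where
  "Kl \<equiv> kleisli C T \<mu> \<eta>"

abbreviation Adj :: "('o, 'm, 'o, 'm) adjunction" where
  "Adj \<equiv> kleisli_adjunction C T \<mu> \<eta>"

lemma right_in_Hom:
  assumes "X \<in> Ob C" "Y \<in> Ob C" "f \<in> Hom C X (omap T Y)"
  shows "amap (right Adj) X Y f \<in> Hom C (omap T X) (omap T Y)"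
  using assms
  by (simp add: kleisli_adjunction_def source.Cmp_in_Hom[where Y = "omap T (omap T Y)"]
      omap_in_Ob amap_in_Hom mult_in_Hom)

text \<open>By associativity: \<open>right Adj\<close> sends \<open>g\<close> to its extension
  \<open>\<mu> Z \<circ> T g\<close>, and the category laws are proved through extensions.\<close>

lemma kleisli_Cmp:
  assumes "X \<in> Ob C" "Y \<in> Ob C" "Z \<in> Ob C" "f \<in> Hom C X (omap T Y)" "g \<in> Hom C Y (omap T Z)"
  shows "Cmp Kl X Y Z g f = Cmp C X (omap T Y) (omap T Z) (amap (right Adj) Y Z g) f"
  using assms
  by (simp add: kleisli_def kleisli_adjunction_def source.Cmp_assoc omap_in_Ob amap_in_Hom
      mult_in_Hom)

text \<open>\<open>\<mu> Y \<circ> T (\<eta> Y)\<close> is the identity, so the right adjoint after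
  the left one acts as \<open>T\<close>.\<close>

lemma right_sharp:
  assumes "X \<in> Ob C" "Y \<in> Ob C" "f \<in> Hom C X Y"
  shows "amap (right Adj) X Y (sharp C T \<eta> X Y f) = amap T X Y f"
  using assms
  by (simp add: kleisli_adjunction_def sharp_def amap_Cmp source.Cmp_assoc omap_in_Ob amap_in_Hom
      mult_in_Hom unit_in_Hom mult_amap_unit source.Cmp_Idt_left)

text \<open>Naturality of \<open>\<eta>\<close> turns \<open>T f \<circ> \<eta> X\<close> into
  \<open>\<eta> (T Y) \<circ> f\<close>, and \<open>\<mu> Y\<close> cancels that unit.\<close>

lemma right_Cmp_unit:
  assumes "X \<in> Ob C" "Y \<in> Ob C" "f \<in> Hom C X (omap T Y)"
  shows "Cmp C X (omap T X) (omap T Y) (amap (right Adj) X Y f) (\<eta> X) = f"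
proof -
  have "Cmp C X (omap T X) (omap T Y) (amap (right Adj) X Y f) (\<eta> X)
      = Cmp C X (omap T (omap T Y)) (omap T Y) (\<mu> Y)
          (Cmp C X (omap T X) (omap T (omap T Y)) (amap T X (omap T Y) f) (\<eta> X))"
    using assms
    by (simp add: kleisli_adjunction_def source.Cmp_assoc omap_in_Ob amap_in_Hom mult_in_Hom
        unit_in_Hom)
  also have "\<dots> = f"
    using assms
    by (simp add: unit_natural source.Cmp_assoc omap_in_Ob mult_in_Hom unit_in_Hom mult_unit
        source.Cmp_Idt_left)
  finally show ?thesis .
qed

lemma right_unit:
  assumes "X \<in> Ob C"
  shows "amap (right Adj) X X (\<eta> X) = Idt C (omap T X)"
  using assms by (simp add: kleisli_adjunction_def mult_amap_unit)

text \<open>The extension \<open>g'\<close> of \<open>g\<close> is a morphism of free algebras,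
  \<open>\<mu> Z \<circ> T g' = g' \<circ> \<mu> Y\<close>, so it can be pulled out of the extension
  of \<open>g' \<circ> f\<close>.\<close>

lemma right_Cmp:
  assumes "X \<in> Ob C" "Y \<in> Ob C" "Z \<in> Ob C" "f \<in> Hom C X (omap T Y)" "g \<in> Hom C Y (omap T Z)"
  shows "amap (right Adj) X Z (Cmp C X (omap T Y) (omap T Z) (amap (right Adj) Y Z g) f)
    = Cmp C (omap T X) (omap T Y) (omap T Z) (amap (right Adj) Y Z g) (amap (right Adj) X Y f)"
proof -
  let ?T = "omap T"
  note typing = assms omap_in_Ob amap_in_Hom mult_in_Hom source.Cmp_in_Hom
  define g' where "g' = amap (right Adj) Y Z g"
  have g': "g' \<in> Hom C (?T Y) (?T Z)"
    using assms by (simp add: g'_def right_in_Hom)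
  have "Cmp C (?T (?T Y)) (?T (?T Z)) (?T Z) (\<mu> Z) (amap T (?T Y) (?T Z) g')
      = Cmp C (?T (?T Y)) (?T (?T Z)) (?T Z) (\<mu> Z)
          (Cmp C (?T (?T Y)) (?T (?T (?T Z))) (?T (?T Z)) (amap T (?T (?T Z)) (?T Z) (\<mu> Z))
            (amap T (?T Y) (?T (?T Z)) (amap T Y (?T Z) g)))"
    by (simp add: g'_def kleisli_adjunction_def amap_Cmp typing)
  \<comment> \<open>Associativity of the monad replaces \<open>T (\<mu> Z)\<close> by
    \<open>\<mu> (T Z)\<close>; naturality of \<open>\<mu>\<close> then moves the multiplication
    past \<open>T g\<close>.\<close>
  also have "\<dots> = Cmp C (?T (?T Y)) (?T (?T Z)) (?T Z) (\<mu> Z)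
          (Cmp C (?T (?T Y)) (?T (?T (?T Z))) (?T (?T Z)) (\<mu> (?T Z))
            (amap T (?T Y) (?T (?T Z)) (amap T Y (?T Z) g)))"
    by (simp add: source.Cmp_assoc typing mult_assoc)
  also have "\<dots> = Cmp C (?T (?T Y)) (?T Y) (?T Z) g' (\<mu> Y)"
    by (simp add: mult_natural[symmetric] g'_def kleisli_adjunction_def source.Cmp_assoc typing)
  finally have g'_natural:
    "Cmp C (?T (?T Y)) (?T (?T Z)) (?T Z) (\<mu> Z) (amap T (?T Y) (?T Z) g')
      = Cmp C (?T (?T Y)) (?T Y) (?T Z) g' (\<mu> Y)" .
  have "amap (right Adj) X Z (Cmp C X (?T Y) (?T Z) g' f)
      = Cmp C (?T X) (?T (?T Y)) (?T Z)
          (Cmp C (?T (?T Y)) (?T (?T Z)) (?T Z) (\<mu> Z) (amap T (?T Y) (?T Z) g'))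
          (amap T X (?T Y) f)"
    by (simp add: kleisli_adjunction_def amap_Cmp source.Cmp_assoc typing g')
  also have "\<dots> = Cmp C (?T X) (?T Y) (?T Z) g' (amap (right Adj) X Y f)"
    by (simp add: g'_natural, simp add: kleisli_adjunction_def source.Cmp_assoc typing g')
  finally show ?thesis
    by (simp add: g'_def)
qed

text \<open>\<open>right_unit\<close> yields the left identity law, \<open>right_Cmp_unit\<close>
  the right one, \<open>right_Cmp\<close> associativity.\<close>

lemma category_kleisli: "category Kl"
proof -
  have Hom: "Hom Kl = (\<lambda>X Y. Hom C X (omap T Y))" and Ob: "Ob Kl = Ob C" and Idt: "Idt Kl = \<eta>"
    by (simp_all add: kleisli_def)
  show ?thesis
    by unfold_locales
      (simp_all add: Hom Ob Idt kleisli_Cmp right_in_Hom right_unit right_Cmp right_Cmp_unit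
        unit_in_Hom omap_in_Ob source.Cmp_in_Hom[where Y = "omap T _"] source.Cmp_Idt_left
        source.Cmp_assoc)
qed

lemma kleisli_triple_kleisli: "kleisli_triple Kl C (right Adj)"
proof -
  interpret Kl: category Kl by (rule category_kleisli)
  have Hom: "Hom Kl = (\<lambda>X Y. Hom C X (omap T Y))" and Ob: "Ob Kl = Ob C" and Idt: "Idt Kl = \<eta>"
    and omap: "omap (right Adj) = omap T"
    by (simp_all add: kleisli_def kleisli_adjunction_def)
  show ?thesis
    by unfold_locales
      (simp_all add: Hom Ob Idt omap kleisli_Cmp right_in_Hom right_unit right_Cmp omap_in_Ob)
qed

end

section \<open>Maps preserving suprema of chains, and the enrichment\<close>

lemma omega_chain_image:
  assumes "preserves_chain_sups A le B le' h" and "reflp_on A le" and "omega_chain A le c"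
  shows "omega_chain B le' (\<lambda>n. h (c n))"
proof -
  have "h x \<in> B \<and> le' (h x) (h y)" if xy: "x \<in> A" "y \<in> A" "le x y" for x y
  proof -
    \<comment> \<open>Monotonicity, from the chain \<open>x \<le> y \<le> y \<le> \<dots>\<close> with supremum \<open>y\<close>.\<close>
    have chain: "chain_sup B le' (\<lambda>n. h (if n = (0::nat) then u else v)) (h v)"
      if "u \<in> A" "v \<in> A" "le u v" for u v
    proof -
      have "le v v" using assms(2) \<open>v \<in> A\<close> by (rule reflp_onD)
      then have "omega_chain A le (\<lambda>n. if n = 0 then u else v)"
        and "chain_sup A le (\<lambda>n. if n = 0 then u else v) v"
        using that by (auto simp: omega_chain_def chain_sup_def split: if_splits)
      then show ?thesis
        using assms(1) unfolding preserves_chain_sups_def by blast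
    qed
    \<comment> \<open>The constant chain at \<open>x\<close> has supremum \<open>x\<close>, and a
      supremum in \<open>B\<close> lies in \<open>B\<close>.\<close>
    have "le x x" using assms(2) \<open>x \<in> A\<close> by (rule reflp_onD)
    then have "h x \<in> B"
      using chain[of x x] xy by (simp add: chain_sup_def)
    moreover have "le' (h x) (h y)"
      using chain[OF xy] unfolding chain_sup_def by (metis (full_types))
    ultimately show ?thesis ..
  qed
  then show ?thesis
    using assms(3) unfolding omega_chain_def by blast
qed

text \<open>\<open>k\<close> can act on the image of a chain because that image is again a chain in
  \<open>B\<close>.\<close>

lemma preserves_chain_sups_comp:
  assumes "preserves_chain_sups A le B le' h" and "preserves_chain_sups B le' D le'' k"
    and "reflp_on A le"
  shows "preserves_chain_sups A le D le'' (\<lambda>x. k (h x))"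
  using assms omega_chain_image[OF assms(1,3)]
  unfolding preserves_chain_sups_def by blast

text \<open>Hom-sets and orders are those of \<open>K\<close> at \<open>X\<close> and
  \<open>S Y\<close>, so the order conditions are inherited; continuity of composition needs
  work.\<close>

lemma cppo_enriched_kleisli:
  assumes "cat_monad K S m e" and "cppo_enriched K le" and "locally_continuous K le K le S"
  shows "cppo_enriched (kleisli K S m e) (\<lambda>X Y. le X (omap S Y))"
proof -
  interpret S: cat_monad K S m e by fact
  interpret cppo_enriched K le by fact
  interpret Kl: category "kleisli K S m e" by (rule S.category_kleisli)
  have S_continuous: "preserves_chain_sups (Hom K X Y) (le X Y)
      (Hom K (omap S X) (omap S Y)) (le (omap S X) (omap S Y)) (amap S X Y)"
    if "X \<in> Ob K" "Y \<in> Ob K" for X Y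
    using assms(3) that by (simp add: locally_continuous_def)
  show ?thesis
  proof
    fix X Y Z g
    assume "X \<in> Ob (kleisli K S m e)" "Y \<in> Ob (kleisli K S m e)" "Z \<in> Ob (kleisli K S m e)"
      "g \<in> Hom (kleisli K S m e) Y Z"
    then have *: "X \<in> Ob K" "Y \<in> Ob K" "Z \<in> Ob K" "g \<in> Hom K Y (omap S Z)"
      by (simp_all add: kleisli_def)
    show "preserves_chain_sups (Hom (kleisli K S m e) X Y) (le X (omap S Y))
        (Hom (kleisli K S m e) X Z) (le X (omap S Z)) (\<lambda>f. Cmp (kleisli K S m e) X Y Z g f)"
      \<comment> \<open>\<open>f\<close> is composed with \<open>S g\<close>, then with
        \<open>m Z\<close>: two postcompositions in \<open>K\<close>.\<close>
      unfolding kleisli_def cat.simps using *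
      by (intro preserves_chain_sups_comp[OF Cmp_left_continuous Cmp_left_continuous])
        (simp_all add: S.omap_in_Ob S.amap_in_Hom S.mult_in_Hom le_refl)
  next
    fix X Y Z f
    assume "X \<in> Ob (kleisli K S m e)" "Y \<in> Ob (kleisli K S m e)" "Z \<in> Ob (kleisli K S m e)"
      "f \<in> Hom (kleisli K S m e) X Y"
    then have *: "X \<in> Ob K" "Y \<in> Ob K" "Z \<in> Ob K" "f \<in> Hom K X (omap S Y)"
      by (simp_all add: kleisli_def)
    show "preserves_chain_sups (Hom (kleisli K S m e) Y Z) (le Y (omap S Z))
        (Hom (kleisli K S m e) X Z) (le X (omap S Z)) (\<lambda>g. Cmp (kleisli K S m e) X Y Z g f)"
      \<comment> \<open>\<open>g\<close> enters through \<open>S\<close>, continuous by assumption,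
        then precomposition with \<open>f\<close>, then postcomposition with
        \<open>m Z\<close>.\<close>
      unfolding kleisli_def cat.simps using *
      by (intro preserves_chain_sups_comp[OF
            preserves_chain_sups_comp[OF S_continuous Cmp_right_continuous] Cmp_left_continuous])
        (simp_all add: S.omap_in_Ob S.mult_in_Hom le_refl)
  qed (simp_all add: kleisli_def S.omap_in_Ob le_refl le_trans le_antisym least chain_complete)
qed

text \<open>A chain in \<open>A\<close> and its supremum lie in \<open>A\<close>, so only values on
  \<open>A\<close> enter.\<close>

lemma preserves_chain_sups_cong:
  assumes "\<And>x. x \<in> A \<Longrightarrow> h x = k x"
  shows "preserves_chain_sups A le B le' h \<longleftrightarrow> preserves_chain_sups A le B le' k"
proof -
  have "(\<lambda>n. h (c n)) = (\<lambda>n. k (c n)) \<and> h s = k s"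
    if "omega_chain A le c" "chain_sup A le c s" for c s
    using assms that by (auto simp: omega_chain_def chain_sup_def)
  then show ?thesis
    unfolding preserves_chain_sups_def by metis
qed

text \<open>\<open>same_category\<close> leaves composites off the hom-sets free, so composition
  maps are exchanged by the congruence rule, not by equality of categories.\<close>

lemma cppo_enriched_same_category:
  assumes "category D" and "same_category D E" and "cppo_enriched E le"
  shows "cppo_enriched D le"
proof -
  interpret D: category D by fact
  interpret cppo_enriched E le by fact
  have Ob: "Ob D = Ob E"
    and Hom: "\<And>X Y. \<lbrakk>X \<in> Ob E; Y \<in> Ob E\<rbrakk> \<Longrightarrow> Hom D X Y = Hom E X Y"
    and Cmp: "\<And>X Y Z f g. \<lbrakk>X \<in> Ob E; Y \<in> Ob E; Z \<in> Ob E; f \<in> Hom E X Y; g \<in> Hom E Y Z\<rbrakk>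
      \<Longrightarrow> Cmp D X Y Z g f = Cmp E X Y Z g f"
    using assms(2) by (simp_all add: same_category_def)
  have left: "preserves_chain_sups (Hom E X Y) (le X Y) (Hom E X Z) (le X Z) (\<lambda>f. Cmp D X Y Z g f)"
    if "X \<in> Ob E" "Y \<in> Ob E" "Z \<in> Ob E" "g \<in> Hom E Y Z" for X Y Z g
    using Cmp_left_continuous[OF that]
    by (rule preserves_chain_sups_cong[THEN iffD2, rotated]) (simp add: Cmp that)
  have right: "preserves_chain_sups (Hom E Y Z) (le Y Z) (Hom E X Z) (le X Z) (\<lambda>g. Cmp D X Y Z g f)"
    if "X \<in> Ob E" "Y \<in> Ob E" "Z \<in> Ob E" "f \<in> Hom E X Y" for X Y Z f
    using Cmp_right_continuous[OF that]
    by (rule preserves_chain_sups_cong[THEN iffD2, rotated]) (simp add: Cmp that)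
  show ?thesis
    by unfold_locales
      (simp_all add: Ob Hom le_refl le_trans le_antisym least chain_complete left right)
qed

section \<open>The composite adjunction and its monad \<open>TS\<close>\<close>

theorem theorem1:
  fixes C :: "('o, 'm) cat"
    and T S S' :: "('o, 'm, 'o, 'm) fctr"
    and \<mu> \<eta> m e :: "'o \<Rightarrow> 'm"
    and le :: "'o \<Rightarrow> 'o \<Rightarrow> 'm \<Rightarrow> 'm \<Rightarrow> bool"
  assumes "category C"
    and "cat_monad C T \<mu> \<eta>"
    and "cat_functor C C S"
    and "lifts_to C T \<mu> \<eta> S S'"
    and "cat_monad (kleisli C T \<mu> \<eta>) S' m e"
    and "cppo_enriched (kleisli C T \<mu> \<eta>) le"
    and "locally_continuous (kleisli C T \<mu> \<eta>) le (kleisli C T \<mu> \<eta>) le S'"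
  shows "let A = composite_adjunction C T \<mu> \<eta> S' m e;
             TS = functor_comp T S;
             KlTS = kleisli C TS (adjunction_mult A) (unit A);
             KlS' = kleisli (kleisli C T \<mu> \<eta>) S' m e;
             le' = (\<lambda>X Y. le X (omap S' Y))
         in same_functor C (functor_comp (right A) (left A)) TS \<and>
            cat_monad C TS (adjunction_mult A) (unit A) \<and>
            same_category KlTS KlS' \<and>
            cppo_enriched KlS' le' \<and>
            cppo_enriched KlTS le'"
proof -
  define K where "K = kleisli C T \<mu> \<eta>"
  define E where "E = kleisli K S' m e"
  define P where "P = kleisli_adjunction C T \<mu> \<eta>"
  define Q where "Q = kleisli_adjunction K S' m e"
  define A where "A = composite_adjunction C T \<mu> \<eta> S' m e"
  interpret T: cat_monad C T \<mu> \<eta> by fact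
  interpret S: cat_functor C C S by fact
  interpret S': cat_monad K S' m e using assms(5) by (simp add: K_def)
  interpret P: kleisli_triple K C "right P"
    using T.kleisli_triple_kleisli by (simp add: K_def P_def)
  interpret Q: kleisli_triple E K "right Q"
    using S'.kleisli_triple_kleisli by (simp add: E_def Q_def)
  interpret R: kleisli_triple E C "functor_comp (right P) (right Q)"
    by (rule kleisli_triple_comp) unfold_locales
  have A: "left A = functor_comp (left Q) (left P)" "right A = functor_comp (right P) (right Q)"
    by (simp_all add: A_def composite_adjunction_def adjunction_comp_def K_def P_def Q_def)
  have [simp]: "omap (right P) = omap T" "omap (right Q) = omap S'"
    "omap (left P) X = X" "omap (left Q) X = X" "amap (left P) = sharp C T \<eta>"
    "amap (left Q) = sharp K S' e" "adjunction.unit P = \<eta>" "adjunction.unit Q = e"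
    "counit P X = Idt C (omap T X)" "counit Q X = Idt K (omap S' X)" for X
    by (simp_all add: P_def Q_def kleisli_adjunction_def)
  have K: "Ob K = Ob C" "Hom K X Y = Hom C X (omap T Y)" "Idt K = \<eta>" for X Y
    by (simp_all add: K_def kleisli_def)
  have E: "Ob E = Ob C" "Hom E X Y = Hom K X (omap S' Y)" "Idt E = e" for X Y
    by (simp_all add: E_def kleisli_def K)
  have S'_omap: "omap S' X = omap S X" if "X \<in> Ob C" for X
    using assms(4) that by (simp add: lifts_to_def)
  have S'_sharp: "amap S' X Y (sharp C T \<eta> X Y f)
      = sharp C T \<eta> (omap S X) (omap S Y) (amap S X Y f)"
    if "X \<in> Ob C" "Y \<in> Ob C" "f \<in> Hom C X Y" for X Y f
    using assms(4) that by (simp add: lifts_to_def)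
  have e_Hom: "e X \<in> Hom C X (omap T (omap S' X))" if "X \<in> Ob C" for X
    using S'.unit_in_Hom that by (simp add: K)
  have S'_Ob: "omap S' X \<in> Ob C" if "X \<in> Ob C" for X
    using S'.omap_in_Ob that by (simp add: K)
  have sharp_Hom: "sharp C T \<eta> X Y f \<in> Hom K X Y" if "X \<in> Ob C" "Y \<in> Ob C" "f \<in> Hom C X Y" for X Y f
    using that by (simp add: sharp_def K T.source.Cmp_in_Hom T.omap_in_Ob T.unit_in_Hom)

  \<comment> \<open>\<open>right_sharp\<close> for the lifted monad leaves \<open>S'\<close> of
    \<open>sharp f\<close>, the lifting makes it \<open>sharp (S f)\<close>, and
    \<open>right_sharp\<close> for \<open>T\<close> leaves \<open>T (S f)\<close>.\<close>
  have RL: "amap (right P) (omap S' X) (omap S' Y)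
      (amap (right Q) X Y (sharp K S' e X Y (sharp C T \<eta> X Y f)))
      = amap T (omap S X) (omap S Y) (amap S X Y f)"
    if "X \<in> Ob C" "Y \<in> Ob C" "f \<in> Hom C X Y" for X Y f
    using that S'.right_sharp[of X Y "sharp C T \<eta> X Y f"]
      T.right_sharp[of "omap S X" "omap S Y" "amap S X Y f"]
    by (simp add: Q_def[symmetric] P_def[symmetric] K(1) sharp_Hom S'_sharp S'_omap S.omap_in_Ob
        S.amap_in_Hom)
  \<comment> \<open>In \<open>K\<close>, composing \<open>e Y\<close> with \<open>sharp f\<close> is
    the extension of \<open>e Y\<close> after \<open>\<eta> Y \<circ> f\<close>; extension cancels
    against \<open>\<eta> Y\<close>.\<close>
  have L: "sharp K S' e X Y (sharp C T \<eta> X Y f) = Cmp C X Y (omap T (omap S' Y)) (e Y) f"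
    if "X \<in> Ob C" "Y \<in> Ob C" "f \<in> Hom C X Y" for X Y f
  proof -
    have "sharp K S' e X Y (sharp C T \<eta> X Y f)
        = Cmp C X (omap T Y) (omap T (omap S' Y)) (amap (right P) Y (omap S' Y) (e Y))
            (Cmp C X Y (omap T Y) (\<eta> Y) f)"
      using that P.Cmp_eq[of X Y "omap S' Y" "sharp C T \<eta> X Y f" "e Y"] sharp_Hom[OF that]
      by (simp add: sharp_def K e_Hom S'_Ob)
    then show ?thesis
      using that P.R_Cmp_Idt_Cmp[of X Y "omap S' Y" "e Y" f] by (simp add: K e_Hom S'_Ob)
  qed
  \<comment> \<open>The composite unit is the extension of \<open>e X\<close> after
    \<open>\<eta> X\<close>, that is \<open>e X\<close> again.\<close>
  have unit: "adjunction.unit A X = e X" if "X \<in> Ob C" for X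
    using that P.R_Cmp_Idt[of X "omap S' X" "e X"]
    by (simp add: A_def composite_adjunction_def adjunction_comp_def K_def[symmetric]
        P_def[symmetric] Q_def[symmetric] K e_Hom S'_Ob)
  have counit: "counit A X = Idt C (omap T (omap S' X))" if X: "X \<in> Ob C" for X
  proof -
    let ?Y = "omap S' X" and ?Z = "omap T (omap S' X)"
    have Y: "?Y \<in> Ob C" and Z: "?Z \<in> Ob C"
      using X S'_Ob T.omap_in_Ob by simp_all
    \<comment> \<open>\<open>Idt C ?Z\<close> is the counit of the first adjunction, a
      \<open>K\<close>-morphism \<open>?Z \<rightarrow> ?Y\<close>; \<open>Idt K ?Y\<close> is that
      of the second, an \<open>E\<close>-morphism \<open>?Y \<rightarrow> X\<close>.\<close>
    have i: "Idt C ?Z \<in> Hom K ?Z ?Y" and j: "Idt K ?Y \<in> Hom K ?Y ?Y"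
      using Y Z T.source.Idt_in_Hom S'.source.Idt_in_Hom by (simp_all add: K)
    have "counit A X = Cmp E ?Z ?Y X (Idt K ?Y) (sharp K S' e ?Z ?Y (Idt C ?Z))"
      by (simp add: A_def composite_adjunction_def adjunction_comp_def K_def[symmetric]
          P_def[symmetric] Q_def[symmetric] E_def[symmetric] Let_def)
    also have "\<dots> = Cmp K ?Z (omap S' ?Y) ?Y (amap (right Q) ?Y X (Idt K ?Y))
        (Cmp K ?Z ?Y (omap S' ?Y) (e ?Y) (Idt C ?Z))"
      using X Y Z i j Q.Cmp_eq[of ?Z ?Y X "sharp K S' e ?Z ?Y (Idt C ?Z)" "Idt K ?Y"]
        S'.source.Cmp_in_Hom[of ?Z ?Y "omap S' ?Y" "Idt C ?Z" "e ?Y"] S'.unit_in_Hom[of ?Y]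
        S'_Ob[of ?Y]
      unfolding sharp_def by (simp add: K(1))
    \<comment> \<open>The extension of \<open>Idt K ?Y\<close> cancels against \<open>e ?Y\<close>,
      leaving \<open>Idt K ?Y\<close> composed with \<open>Idt C ?Z\<close> in
      \<open>K\<close>.\<close>
    also have "\<dots> = Idt C ?Z"
      using X Y Z i j Q.R_Cmp_Idt_Cmp[of ?Z ?Y X "Idt K ?Y" "Idt C ?Z"]
        S'.source.Cmp_Idt_left[of ?Z ?Y "Idt C ?Z"]
      by (simp add: K(1) E(3))
    finally show ?thesis .
  qed

  have same_functor: "same_functor C (functor_comp (right A) (left A)) (functor_comp T S)"
    using RL by (simp add: same_functor_def A functor_comp_def S'_omap)
  \<comment> \<open>The facts \<open>omap_TS\<close> to \<open>unit_TS\<close> match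
    \<open>TS\<close> and the unit and multiplication of \<open>A\<close> with the data derived from
    the composed triple.\<close>
  have omap_TS: "omap (functor_comp T S) X = omap (functor_comp (right P) (right Q)) X"
    if "X \<in> Ob C" for X
    using that by (simp add: functor_comp_def S'_omap)
  have amap_TS: "amap (functor_comp T S) X Y f = amap (functor_comp (right P) (right Q)) X Y
      (Cmp C X Y (omap (functor_comp (right P) (right Q)) Y) (Idt E Y) f)"
    if "X \<in> Ob C" "Y \<in> Ob C" "f \<in> Hom C X Y" for X Y f
    using RL[OF that] L[OF that] by (simp add: functor_comp_def E(3))
  have mult_TS: "adjunction_mult A X = amap (functor_comp (right P) (right Q))
      (omap (functor_comp (right P) (right Q)) X) X
      (Idt C (omap (functor_comp (right P) (right Q)) X))"
    if "X \<in> Ob C" for X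
    using that by (simp add: adjunction_mult_def Let_def A functor_comp_def counit)
  have unit_TS: "adjunction.unit A X = Idt E X" if "X \<in> Ob C" for X
    using that by (simp add: unit E(3))
  note TS = omap_TS amap_TS mult_TS unit_TS
  have monad: "cat_monad C (functor_comp T S) (adjunction_mult A) (adjunction.unit A)"
    by (rule R.cat_monad) (fact TS)+
  have same: "same_category (kleisli C (functor_comp T S) (adjunction_mult A) (adjunction.unit A)) E"
    by (rule R.same_category_kleisli) (fact TS)+
  have cppo: "cppo_enriched E (\<lambda>X Y. le X (omap S' Y))"
    unfolding E_def using assms(6,7) by (intro cppo_enriched_kleisli S'.cat_monad_axioms)
      (simp_all add: K_def)
  have "cppo_enriched (kleisli C (functor_comp T S) (adjunction_mult A) (adjunction.unit A))
      (\<lambda>X Y. le X (omap S' Y))"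
    by (rule cppo_enriched_same_category[OF cat_monad.category_kleisli[OF monad] same cppo])
  then show ?thesis
    using same_functor monad same cppo
    unfolding Let_def A_def[symmetric] K_def[symmetric] E_def[symmetric] by blast
qed

end
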